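(* Suppose that, for each $t=1,\dots,T$, $f_t:Q\to\mathbb{R}$ is $M_t$-relatively Lipschitz-continuous and $\mu_t$-strongly convex with respect to the prox-function $h$. Let $x_1,\dots,x_T$ be produced by the online Mirror Descent algorithm described in the context with $\eta_{t+1}=\frac{1}{\mu_{1:t}}$. Then $$\mathrm{Regret}_T\le\sum_{t=1}^{T}\frac{M_t^2}{\mu_{1:t}}.$$
   Context: $Q\subset\mathbb{R}^n$ is a closed convex set, and $h$ is a convex, continuously differentiable function (prox-function), defined on a convex set containing $Q$ and the points $y_{t+1}$ below. Its Bregman divergence is $V(y,x)=h(y)-h(x)-\langle\nabla h(x),y-x\rangle$. For a convex function $f$, $\nabla f(x)$ denotes its (sub)gradient at $x$ (the one used by the algorithm). A convex function $f:Q\to\mathbb{R}$ is $M$-relatively Lipschitz-continuous (with respect to $h$), $M>0$, if $\langle\nabla f(x),y-x\rangle+M\sqrt{2V(y,x)}\ge 0$ for all $x,y\in Q$. A function $f$ is $\mu$-strongly convex with respect to $h$ if $f(x)\ge f(y)+\langle\nabla f(y),x-y\rangle+\mu V(x,y)$ for all $x,y\in Q$. Notation: $\mu_{1:t}=\sum_{s=1}^{t}\mu_s$ and $\mu_{1:0}=0$, where $\mu_t\ge 0$ and $\mu_1>0$ (so that all step sizes are defined). Algorithm. Choose $x_1\in Q$ arbitrarily. For $t=1,\dots,T$: predict $x_t$, observe $f_t$, let $y_{t+1}$ be such that $\nabla h(y_{t+1})=\nabla h(x_t)-\eta_{t+1}\nabla f_t(x_t)$, and let $x_{t+1}=\arg\min_{x\in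 Q}V(x,y_{t+1})$. (The points $y_{t+1}$ and $x_{t+1}$ are assumed to exist.) The regret is $$\mathrm{Regret}_T=\sum_{t=1}^T f_t(x_t)-\min_{x\in Q}\sum_{t=1}^T f_t(x),$$ where the minimum is assumed to be attained. *)

theory Defs
  imports "HOL-Analysis.Analysis"
begin

text \<open>
  Euclidean space is rendered by the type class \<^class>\<open>euclidean_space\<close>.  Gradients and
  subgradients are passed as explicit vector fields: \<open>gh\<close> is the gradient of \<open>h\<close>, and \<open>g\<close> is the
  (sub)gradient of \<open>f\<close> used by the algorithm.  Functions are total in HOL, but only their values
  on the stated domains (\<open>D\<close> for \<open>h\<close>, \<open>Q\<close> for \<open>f\<close>) are ever constrained or used.
\<close>

text \<open>
  The domain \<open>D\<close> of the prox-function need not be open, so the gradient is taken relative to \<open>D\<close>.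
  If \<open>D\<close> has empty interior such a gradient is not unique; \<open>gh\<close> is then any continuous choice.
\<close>

definition prox_function ::
    "'a::euclidean_space set \<Rightarrow> ('a \<Rightarrow> real) \<Rightarrow> ('a \<Rightarrow> 'a) \<Rightarrow> bool" where
  "prox_function D h gh \<longleftrightarrow>
     convex D \<and> convex_on D h \<and>
     (\<forall>x\<in>D. (h has_derivative (\<lambda>v. gh x \<bullet> v)) (at x within D)) \<and>
     continuous_on D gh"

definition bregman ::
    "('a::euclidean_space \<Rightarrow> real) \<Rightarrow> ('a \<Rightarrow> 'a) \<Rightarrow> 'a \<Rightarrow> 'a \<Rightarrow> real" where
  "bregman h gh y x = h y - h x - gh x \<bullet> (y - x)"

definition subgradient_field ::
    "'a::euclidean_space set \<Rightarrow> ('a \<Rightarrow> real) \<Rightarrow> ('a \<Rightarrow> 'a) \<Rightarrow> bool" where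
  "subgradient_field Q f g \<longleftrightarrow> (\<forall>x\<in>Q. \<forall>y\<in>Q. f y \<ge> f x + g x \<bullet> (y - x))"

text \<open>Relative Lipschitz continuity depends on the convex function only through its (sub)gradient.\<close>

definition relatively_lipschitz ::
    "'a::euclidean_space set \<Rightarrow> ('a \<Rightarrow> real) \<Rightarrow> ('a \<Rightarrow> 'a) \<Rightarrow> real \<Rightarrow> ('a \<Rightarrow> 'a) \<Rightarrow> bool" where
  "relatively_lipschitz Q h gh M g \<longleftrightarrow>
     M > 0 \<and> (\<forall>x\<in>Q. \<forall>y\<in>Q. g x \<bullet> (y - x) + M * sqrt (2 * bregman h gh y x) \<ge> 0)"

definition relatively_strongly_convex ::
    "'a::euclidean_space set \<Rightarrow> ('a \<Rightarrow> real) \<Rightarrow> ('a \<Rightarrow> 'a) \<Rightarrow> real \<Rightarrow>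
     ('a \<Rightarrow> real) \<Rightarrow> ('a \<Rightarrow> 'a) \<Rightarrow> bool" where
  "relatively_strongly_convex Q h gh \<mu> f g \<longleftrightarrow>
     (\<forall>x\<in>Q. \<forall>y\<in>Q. f x \<ge> f y + g y \<bullet> (x - y) + \<mu> * bregman h gh x y)"

text \<open>
  A relational description of the runs of the algorithm: \<open>h\<close> is not assumed to be strictly convex,
  so neither \<open>y (t + 1)\<close> nor \<open>x (t + 1)\<close> has to be unique.
\<close>

definition online_mirror_descent ::
    "'a::euclidean_space set \<Rightarrow> 'a set \<Rightarrow> ('a \<Rightarrow> real) \<Rightarrow> ('a \<Rightarrow> 'a) \<Rightarrow> (nat \<Rightarrow> 'a \<Rightarrow> 'a) \<Rightarrow>
     (nat \<Rightarrow> real) \<Rightarrow> nat \<Rightarrow> (nat \<Rightarrow> 'a) \<Rightarrow> (nat \<Rightarrow> 'a) \<Rightarrow> bool" where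
  "online_mirror_descent Q D h gh g \<eta> T x y \<longleftrightarrow>
     x 1 \<in> Q \<and>
     (\<forall>t\<in>{1..T}.
        y (t + 1) \<in> D \<and>
        gh (y (t + 1)) = gh (x t) - \<eta> (t + 1) *\<^sub>R g t (x t) \<and>
        is_arg_min (\<lambda>z. bregman h gh z (y (t + 1))) (\<lambda>z. z \<in> Q) (x (t + 1)))"

text \<open>The infimum is the minimum whenever the latter is attained.\<close>

definition regret ::
    "'a::euclidean_space set \<Rightarrow> (nat \<Rightarrow> 'a \<Rightarrow> real) \<Rightarrow> nat \<Rightarrow> (nat \<Rightarrow> 'a) \<Rightarrow> real" where
  "regret Q f T x = (\<Sum>t=1..T. f t (x t)) - (INF z\<in>Q. \<Sum>t=1..T. f t z)"

end

theory Submission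
  imports Defs
begin

text \<open>
  The three-point identity, the first-order optimality condition for \<open>x (t + 1)\<close> and relative
  Lipschitz continuity bound \<open>\<eta> (t + 1) * (g t (x t) \<bullet> (x t - z))\<close> by
  \<open>V z (x t) - V z (x (t + 1))\<close> plus a quadratic expression in \<open>sqrt (2 * V (x (t + 1)) (x t))\<close>
  that is at most \<open>(\<eta> (t + 1) * M t)\<^sup>2 / 2\<close>, where \<open>V\<close> is the Bregman divergence.
  Strong convexity subtracts \<open>\<mu> t * V z (x t)\<close>, which for the step size \<open>1 / \<mu>\<^sub>1\<^sub>:\<^sub>t\<close> makes
  the divergence terms telescope.
\<close>

text \<open>Along the segment from \<open>a\<close> to \<open>b\<close> the difference quotients are
  at most \<open>c\<close>, and they tend to \<open>L (b - a)\<close>. The limit is one-sided, as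
  befits a derivative within a convex set with \<open>a\<close> possibly on its boundary.\<close>

lemma directional_derivative_le:
  fixes \<phi> :: "'a::real_normed_vector \<Rightarrow> real"
  assumes der: "(\<phi> has_derivative L) (at a within S)"
    and S: "convex S" "a \<in> S" "b \<in> S"
    and bound: "\<And>s. 0 < s \<Longrightarrow> s \<le> 1 \<Longrightarrow> \<phi> (a + s *\<^sub>R (b - a)) - \<phi> a \<le> s * c"
  shows "L (b - a) \<le> c"
proof -
  have seg: "a + s *\<^sub>R (b - a) \<in> S" if "s \<in> {0..1}" for s
    using S that convexD_alt[of S a b s] by (simp add: algebra_simps)
  have "((\<lambda>s. a + s *\<^sub>R (b - a)) has_derivative (\<lambda>s. s *\<^sub>R (b - a))) (at 0 within {0..1})"
    by (auto intro!: derivative_eq_intros)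
  moreover have "(\<phi> has_derivative L)
      (at (a + 0 *\<^sub>R (b - a)) within (\<lambda>s. a + s *\<^sub>R (b - a)) ` {0..1})"
    using der seg by (auto intro: has_derivative_subset)
  ultimately have "((\<lambda>s. \<phi> (a + s *\<^sub>R (b - a))) has_derivative (\<lambda>s. L (s *\<^sub>R (b - a))))
      (at 0 within {0..1})"
    by (rule has_derivative_in_compose)
  moreover have "L (s *\<^sub>R (b - a)) = L (b - a) * s" for s
    using der by (simp add: has_derivative_def bounded_linear.linear linear_cmul)
  ultimately have "((\<lambda>s. \<phi> (a + s *\<^sub>R (b - a))) has_field_derivative L (b - a)) (at 0 within {0..1})"
    by (simp add: has_field_derivative_def)
  then have "((\<lambda>s. (\<phi> (a + s *\<^sub>R (b - a)) - \<phi> a) / s) \<longlongrightarrow> L (b - a)) (at 0 within {0..1})"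
    by (simp add: has_field_derivative_iff)
  moreover have "\<forall>\<^sub>F s in at 0 within {0..1}. (\<phi> (a + s *\<^sub>R (b - a)) - \<phi> a) / s \<le> c"
    unfolding eventually_at_filter
    by (rule always_eventually) (auto simp: divide_le_eq mult.commute intro!: bound)
  moreover have "at (0::real) within {0..1} \<noteq> bot"
    by (simp add: at_within_Icc_at_right)
  ultimately show ?thesis
    by (intro tendsto_upperbound)
qed

text \<open>This is the gradient inequality for convex \<open>h\<close>: convexity bounds the
  difference quotients from \<open>x\<close> towards \<open>z\<close> by
  \<open>h z - h x\<close>.\<close>

lemma bregman_nonneg:
  assumes "prox_function D h gh" "x \<in> D" "z \<in> D"
  shows "0 \<le> bregman h gh z x"
proof -
  have "gh x \<bullet> (z - x) \<le> h z - h x"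
  proof (rule directional_derivative_le)
    show "(h has_derivative (\<lambda>v. gh x \<bullet> v)) (at x within D)" "convex D" "x \<in> D" "z \<in> D"
      using assms by (auto simp: prox_function_def)
    fix s :: real assume "0 < s" "s \<le> 1"
    then have "h ((1 - s) *\<^sub>R x + s *\<^sub>R z) \<le> (1 - s) * h x + s * h z"
      using assms by (intro convex_onD) (auto simp: prox_function_def)
    then show "h (x + s *\<^sub>R (z - x)) - h x \<le> s * (h z - h x)"
      by (simp add: algebra_simps)
  qed
  then show ?thesis
    by (simp add: bregman_def)
qed

lemma bregman_three_point:
  "bregman h gh z x - bregman h gh z y + bregman h gh x y = (gh x - gh y) \<bullet> (x - z)"
  by (simp add: bregman_def algebra_simps)

text \<open>First-order optimality of \<open>p\<close> on \<open>Q\<close> gives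
  \<open>(gh p - gh y) \<bullet> (z - p) \<ge> 0\<close>; the three-point identity through
  \<open>p\<close> turns this into a Pythagorean inequality.\<close>

lemma bregman_projection:
  assumes prox: "prox_function D h gh" and Q: "convex Q" "Q \<subseteq> D"
    and p: "is_arg_min (\<lambda>z. bregman h gh z y) (\<lambda>z. z \<in> Q) p" and "z \<in> Q"
  shows "bregman h gh z p + bregman h gh p y \<le> bregman h gh z y"
proof -
  have pQ: "p \<in> Q" and min: "\<And>w. w \<in> Q \<Longrightarrow> bregman h gh p y \<le> bregman h gh w y"
    using p by (auto simp: is_arg_min_linorder)
  have "(h has_derivative (\<lambda>v. gh p \<bullet> v)) (at p within Q)"
    using prox Q pQ by (auto simp: prox_function_def intro: has_derivative_subset)
  \<comment> \<open>The sign is flipped so that minimality of \<open>p\<close> becomes an upper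
    bound on increments, with \<open>c = 0\<close>.\<close>
  then have "((\<lambda>w. - bregman h gh w y) has_derivative (\<lambda>v. - (gh p \<bullet> v - gh y \<bullet> v))) (at p within Q)"
    unfolding bregman_def by (auto intro!: derivative_eq_intros)
  then have "- (gh p \<bullet> (z - p) - gh y \<bullet> (z - p)) \<le> 0"
  proof (rule directional_derivative_le)
    fix s :: real assume "0 < s" "s \<le> 1"
    then have "p + s *\<^sub>R (z - p) \<in> Q"
      using Q pQ \<open>z \<in> Q\<close> convexD_alt[of Q p z s] by (simp add: algebra_simps)
    from min[OF this]
    show "- bregman h gh (p + s *\<^sub>R (z - p)) y - - bregman h gh p y \<le> s * 0"
      by simp
  qed (use Q pQ \<open>z \<in> Q\<close> in auto)
  then show ?thesis
    using bregman_three_point[of h gh z p y] by (simp add: algebra_simps)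
qed

lemma mirror_step:
  assumes prox: "prox_function D h gh" and Q: "convex Q" "Q \<subseteq> D"
    and lip: "relatively_lipschitz Q h gh M g"
    and "0 \<le> \<eta>" "x \<in> Q" "z \<in> Q"
    and y: "gh y = gh x - \<eta> *\<^sub>R g x"
    and p: "is_arg_min (\<lambda>z. bregman h gh z y) (\<lambda>z. z \<in> Q) p"
  shows "\<eta> * (g x \<bullet> (x - z)) \<le> bregman h gh z x - bregman h gh z p + (\<eta> * M)\<^sup>2 / 2"
proof -
  have pQ: "p \<in> Q"
    using p by (simp add: is_arg_min_def)
  define r where "r = sqrt (2 * bregman h gh p x)"
  \<comment> \<open>\<open>sqrt\<close> is negative at negative arguments, so squaring
    \<open>r\<close> gives the divergence back only if that is nonnegative.\<close>
  have "0 \<le> bregman h gh p x"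
    using bregman_nonneg[OF prox] Q pQ \<open>x \<in> Q\<close> by auto
  then have r: "r\<^sup>2 = 2 * bregman h gh p x"
    by (simp add: r_def)
  have "g x \<bullet> (x - p) \<le> M * r"
    using lip \<open>x \<in> Q\<close> pQ by (force simp: relatively_lipschitz_def r_def inner_diff_right)
  then have "\<eta> * (g x \<bullet> (x - p)) \<le> \<eta> * M * r"
    using mult_left_mono[OF _ \<open>0 \<le> \<eta>\<close>] by (simp add: mult.assoc)
  \<comment> \<open>Used at \<open>w = z\<close> and \<open>w = p\<close>: subtracting the two
    instances cancels \<open>bregman h gh x y\<close>.\<close>
  moreover have "\<eta> * (g x \<bullet> (x - w)) =
      bregman h gh w x - bregman h gh w y + bregman h gh x y" for w
    using bregman_three_point[of h gh w x y] by (simp add: y)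
  moreover have "bregman h gh z p + bregman h gh p y \<le> bregman h gh z y"
    by (rule bregman_projection[OF prox Q p \<open>z \<in> Q\<close>])
  \<comment> \<open>Completing the square: \<open>\<eta> * M * r - r\<^sup>2 / 2\<close> is at most
    \<open>(\<eta> * M)\<^sup>2 / 2\<close>.\<close>
  moreover have "0 \<le> (\<eta> * M - r)\<^sup>2"
    by simp
  ultimately show ?thesis
    using r by (simp add: power2_diff)
qed

theorem theorem2:
  fixes Q D :: "'a::euclidean_space set"
    and h :: "'a \<Rightarrow> real" and gh :: "'a \<Rightarrow> 'a"
    and f :: "nat \<Rightarrow> 'a \<Rightarrow> real" and g :: "nat \<Rightarrow> 'a \<Rightarrow> 'a"
    and M \<mu> \<eta> :: "nat \<Rightarrow> real"
    and x y :: "nat \<Rightarrow> 'a"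
    and T :: nat
  assumes "closed Q" and "convex Q" and "Q \<subseteq> D"
    and "prox_function D h gh"
    and "\<And>t. t \<in> {1..T} \<Longrightarrow> convex_on Q (f t)"
    and "\<And>t. t \<in> {1..T} \<Longrightarrow> subgradient_field Q (f t) (g t)"
    and "\<And>t. t \<in> {1..T} \<Longrightarrow> relatively_lipschitz Q h gh (M t) (g t)"
    and "\<And>t. t \<in> {1..T} \<Longrightarrow> relatively_strongly_convex Q h gh (\<mu> t) (f t) (g t)"
    and "\<And>t. t \<in> {1..T} \<Longrightarrow> \<mu> t \<ge> 0" and "\<mu> 1 > 0"
    and "\<And>t. t \<in> {1..T} \<Longrightarrow> \<eta> (t + 1) = 1 / (\<Sum>s=1..t. \<mu> s)"
    and "online_mirror_descent Q D h gh g \<eta> T x y"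
    and "\<exists>z. is_arg_min (\<lambda>z. \<Sum>t=1..T. f t z) (\<lambda>z. z \<in> Q) z"
  shows "regret Q f T x \<le> (\<Sum>t=1..T. (M t)\<^sup>2 / (\<Sum>s=1..t. \<mu> s))"
proof -
  let ?V = "bregman h gh"
  define S where "S t = (\<Sum>s=1..t. \<mu> s)" for t
  note prox = assms(4)
  have alg: "x 1 \<in> Q"
    "\<And>t. t \<in> {1..T} \<Longrightarrow> gh (y (t + 1)) = gh (x t) - \<eta> (t + 1) *\<^sub>R g t (x t)"
    "\<And>t. t \<in> {1..T} \<Longrightarrow> is_arg_min (\<lambda>z. ?V z (y (t + 1))) (\<lambda>z. z \<in> Q) (x (t + 1))"
    using assms(12) by (auto simp: online_mirror_descent_def)
  \<comment> \<open>The range includes \<open>T + 1\<close> because the telescoped sum ends with the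
    divergence from \<open>x (T + 1)\<close>.\<close>
  have xQ: "x t \<in> Q" if "t \<in> {1..T + 1}" for t
  proof (cases "t = 1")
    case False
    then have "t - 1 \<in> {1..T}" "t = (t - 1) + 1"
      using that by auto
    then show ?thesis
      using alg(3)[of "t - 1"] by (simp add: is_arg_min_def)
  qed (use alg(1) in simp)
  have S_pos: "0 < S t" if "t \<in> {1..T}" for t
  proof -
    have "\<mu> 1 \<le> S t"
      unfolding S_def by (rule member_le_sum) (use that assms(9) in auto)
    then show ?thesis
      using assms(10) by linarith
  qed
  obtain z where z: "z \<in> Q" "\<And>w. w \<in> Q \<Longrightarrow> (\<Sum>t=1..T. f t z) \<le> (\<Sum>t=1..T. f t w)"
    using assms(13) by (auto simp: is_arg_min_linorder)
  have step: "f t (x t) - f t z \<le>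
      S (t - 1) * ?V z (x t) - S t * ?V z (x (t + 1)) + (M t)\<^sup>2 / S t"
    if t: "t \<in> {1..T}" for t
  proof -
    have pos: "0 < S t" and x: "x t \<in> Q"
      using S_pos xQ t by auto
    have "\<eta> (t + 1) = 1 / S t"
      using assms(11) t by (simp add: S_def)
    with mirror_step[OF prox assms(2,3) assms(7)[OF t] _ x z(1) alg(2,3)[OF t]] pos
    have "1 / S t * (g t (x t) \<bullet> (x t - z)) \<le>
        ?V z (x t) - ?V z (x (t + 1)) + (1 / S t * M t)\<^sup>2 / 2"
      by simp
    \<comment> \<open>Scaling by \<open>S t\<close> cancels the step size and one of the two factors
      \<open>1 / S t\<close> in the quadratic term.\<close>
    from mult_left_mono[OF this, of "S t"] pos
    have "g t (x t) \<bullet> (x t - z) \<le> S t * (?V z (x t) - ?V z (x (t + 1))) + (M t)\<^sup>2 / S t / 2"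
      by (simp add: distrib_left power2_eq_square)
    \<comment> \<open>The argument yields half of the claimed error term; the factor 1/2 is given
      away here.\<close>
    also have "\<dots> \<le> S t * (?V z (x t) - ?V z (x (t + 1))) + (M t)\<^sup>2 / S t"
      using pos by (simp add: frac_le)
    finally have "g t (x t) \<bullet> (x t - z) \<le> S t * (?V z (x t) - ?V z (x (t + 1))) + (M t)\<^sup>2 / S t" .
    moreover have "f t (x t) - f t z \<le> g t (x t) \<bullet> (x t - z) - \<mu> t * ?V z (x t)"
      using assms(8)[OF t] z(1) x
      by (force simp: relatively_strongly_convex_def inner_diff_right)
    \<comment> \<open>Since \<open>t \<ge> 1\<close>, the natural subtraction is not truncated;
      \<open>S 0\<close> is the empty sum.\<close>
    moreover have "S (t - 1) = S t - \<mu> t"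
      using t by (cases t) (auto simp: S_def)
    ultimately show ?thesis
      by (simp only: left_diff_distrib right_diff_distrib)
  qed
  \<comment> \<open>The divergence from the arbitrary start \<open>x 1\<close> has coefficient
    \<open>S 0 = 0\<close>, so only the final term survives.\<close>
  have "(\<Sum>t=1..T. S (t - 1) * ?V z (x t) - S t * ?V z (x (t + 1))) = - S T * ?V z (x (T + 1))"
    by (induction T) (auto simp: S_def algebra_simps)
  also have "\<dots> \<le> 0"
  proof (cases "T = 0")
    case False
    then have "0 < S T" "0 \<le> ?V z (x (T + 1))"
      using S_pos xQ z(1) assms(3) by (auto intro!: bregman_nonneg[OF prox])
    then show ?thesis
      by simp
  qed (simp add: S_def)
  finally have "(\<Sum>t=1..T. f t (x t) - f t z) \<le> (\<Sum>t=1..T. (M t)\<^sup>2 / S t)"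
    using sum_mono[OF step, of "{1..T}" "\<lambda>t. t"] by (simp add: sum.distrib)
  \<comment> \<open>The minimiser \<open>z\<close> supplies the lower bound on all values over
    \<open>Q\<close> that passes to the infimum in \<open>regret\<close>.\<close>
  moreover have "(\<Sum>t=1..T. f t z) \<le> (INF w\<in>Q. \<Sum>t=1..T. f t w)"
    using z by (intro cINF_greatest) auto
  ultimately show ?thesis
    by (simp add: regret_def sum_subtractf S_def)
qed

end
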